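(* Let $m\ge 0$, $n\ge 1$, $d\ge 1$ be integers, let $\mathbf p=(\mathbf p_0,\dots,\mathbf p_{n-1})\in\mathbb R^{n\times d}$, and let $f_{\mathbf p}:[0,1)\to\mathbb R^d$ be the periodic spline with Eulerian coefficients defined in the context. Then $f_{\mathbf p}$ is expressed in the B-spline basis with control points exactly the $\mathbf p_i$: for all $t\in[0,1)$, $$f_{\mathbf p}(t)=\sum_{i\in\mathbb Z}B^m(nt-i)\,\mathbf p_i,\qquad\text{where}\qquad B^m(x)=\frac1{m!}\sum_{k=0}^{m+1}(-1)^k\binom{m+1}{k}(x-k)^m_+ .$$ Moreover $B^m(x)=0$ for $x\notin[0,m+1)$, so that for each fixed $t$ the sum over $i\in\mathbb Z$ has only finitely many nonzero terms, and the right-hand side defines a $1$-periodic function of $t\in\mathbb R$.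
   Context: Indices of $\mathbf p$ are read modulo $n$: $\mathbf p_i=\mathbf p_{i\bmod n}$ for $i\in\mathbb Z$. For a finitely supported kernel $K=(K_j)_{j\in\mathbb Z}$ write $(K\star\mathbf p)_i=\sum_{j\in\mathbb Z}K_j\mathbf p_{i-j}$ (convolution modulo $n$). The discrete derivative of order $k$ is $(\Delta^{\star k}\star\mathbf p)_i=\sum_{j=0}^k(-1)^j\binom kj\mathbf p_{i-j}$. Eulerian coefficients: $C^0$ is the convolution identity ($C^0_0=1$, $C^0_i=0$ for $i\ne0$), and for $r\ge1$, $C^r_i=E^r_{i-1}/r!$, where $E^r_j$ is the Eulerian number of degree $r$ (the number of permutations of $\{1,\dots,r\}$ with exactly $j$ descents, equal to $0$ unless $0\le j\le r-1$). The function $f_{\mathbf p}$ is defined for $t\in[0,1)$ by $$f_{\mathbf p}(t)=\sum_{i=0}^{n-1}g_i(nt-i),\qquad g_i(x)=\sum_{k=0}^m(C^{m-k}\star\Delta^{\star k}\star\mathbf p)_i\,\frac{x^k}{k!}\,\chi_{0\le x<1},$$ where $\chi_{0\le x<1}$ is $1$ if $0\le x<1$ and $0$ otherwise. $(a)^m_+$ denotes the $m$-th power of the positive part of $a$ (for $m=0$: $(a)^0_+=1$ if $a\ge0$ and $0$ if $a<0$). *)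

theory Defs
  imports "HOL-Analysis.Analysis"
begin

text \<open>Control points are the values \<open>p 0, \<dots>, p (n - 1)\<close>; the values of \<open>p\<close> at
  other arguments are never used, since indices are reduced modulo \<open>n\<close>.\<close>

definition cyc :: "nat \<Rightarrow> (nat \<Rightarrow> 'a) \<Rightarrow> int \<Rightarrow> 'a" where
  "cyc n p i = p (nat (i mod int n))"

text \<open>Only meant for kernels \<open>K\<close> of finite support: the sum over all integers \<open>j\<close> is
  written as the finite sum over the support.\<close>

definition conv :: "(int \<Rightarrow> real) \<Rightarrow> (int \<Rightarrow> 'a::real_vector) \<Rightarrow> int \<Rightarrow> 'a" where
  "conv K q i = (\<Sum>j\<in>{j. K j \<noteq> 0}. K j *\<^sub>R q (i - j))"

definition discrete_deriv :: "nat \<Rightarrow> (int \<Rightarrow> 'a::real_vector) \<Rightarrow> int \<Rightarrow> 'a" where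
  "discrete_deriv k q i = (\<Sum>j=0..k. ((-1) ^ j * real (k choose j)) *\<^sub>R q (i - int j))"

definition eulerian :: "nat \<Rightarrow> int \<Rightarrow> nat" where
  "eulerian r j =
     card {\<pi>. \<pi> permutes {1..r} \<and> int (card {i \<in> {1..<r}. \<pi> i > \<pi> (Suc i)}) = j}"

definition eulerian_coeff :: "nat \<Rightarrow> int \<Rightarrow> real" where
  "eulerian_coeff r i =
     (if r = 0 then (if i = 0 then 1 else 0) else real (eulerian r (i - 1)) / fact r)"

definition spline_piece ::
    "nat \<Rightarrow> nat \<Rightarrow> (nat \<Rightarrow> 'a::real_vector) \<Rightarrow> int \<Rightarrow> real \<Rightarrow> 'a" where
  "spline_piece m n p i x =
     (\<Sum>k=0..m. (x ^ k / fact k * indicator {0..<1} x) *\<^sub>R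
        conv (eulerian_coeff (m - k)) (discrete_deriv k (cyc n p)) i)"

text \<open>The periodic spline, meaningful for \<open>t\<close> in \<open>{0..<1}\<close>.\<close>

definition periodic_spline ::
    "nat \<Rightarrow> nat \<Rightarrow> (nat \<Rightarrow> 'a::real_vector) \<Rightarrow> real \<Rightarrow> 'a" where
  "periodic_spline m n p t = (\<Sum>i=0..<n. spline_piece m n p (int i) (real n * t - real i))"

text \<open>The case \<open>m = 0\<close> is separate because \<open>max a 0 ^ 0 = 1\<close> also for negative \<open>a\<close>.\<close>

definition pos_power :: "nat \<Rightarrow> real \<Rightarrow> real" where
  "pos_power m a = (if m = 0 then (if a \<ge> 0 then 1 else 0) else (max a 0) ^ m)"

definition bspline :: "nat \<Rightarrow> real \<Rightarrow> real" where
  "bspline m x =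
     1 / fact m * (\<Sum>k=0..m + 1. (-1) ^ k * real ((m + 1) choose k) * pos_power m (x - real k))"

end

theory Submission
  imports Defs "HOL-Combinatorics.Multiset_Permutations"
begin

text \<open>Let \<open>T\<^sub>r\<close> be the sequence \<open>j\<^sup>r / r!\<close> on \<open>j \<ge> 0\<close>, extended by \<open>0\<close>. Since \<open>B\<^sup>m\<close> is the
  difference of order \<open>m + 1\<close> of the truncated power, expanding \<open>(u + j)\<^sup>m\<close> by the binomial theorem
  for \<open>0 \<le> u < 1\<close> makes the coefficient of \<open>u\<^sup>k / k!\<close> in \<open>B\<^sup>m (u + j)\<close> equal to the difference of
  order \<open>k + (m - k + 1)\<close> of \<open>T\<^sub>r\<close> with \<open>r = m - k\<close>. By the explicit formula for the Eulerian numbers,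
  \<open>C\<^sup>r\<close> is the difference of order \<open>r + 1\<close> of \<open>T\<^sub>r\<close>, so this coefficient is the one in the
  spline piece. The explicit formula follows from the recurrence
  \<open>E\<^sup>r\<^sup>+\<^sup>1(j) = (j + 1) E\<^sup>r(j) + (r - j + 1) E\<^sup>r(j - 1)\<close>, obtained by inserting the largest letter into
  a permutation: the number of descents is unchanged if it goes to the end or into a descent, and
  grows by one otherwise.\<close>

section \<open>Descents of words and insertion of a largest letter\<close>

fun descents :: "'a::linorder list \<Rightarrow> nat" where
  "descents (x # y # xs) = (if x > y then 1 else 0) + descents (y # xs)"
| "descents _ = 0"

lemma descents_conv_card:
  "descents xs = card {i. Suc i < length xs \<and> xs ! i > xs ! Suc i}"
proof (induction xs rule: descents.induct)
  case (1 x y xs)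
  let ?D = "\<lambda>xs. {i. Suc i < length xs \<and> xs ! i > xs ! Suc i}"
  have "?D (x # y # xs) = (if x > y then {0} else {}) \<union> Suc ` ?D (y # xs)" (is "?L = ?R")
  proof (rule set_eqI)
    show "i \<in> ?L \<longleftrightarrow> i \<in> ?R" for i
      by (cases i) auto
  qed
  moreover have "finite (?D (y # xs))"
    by (rule finite_subset[of _ "{..<length (y # xs)}"]) auto
  ultimately show ?case
    using 1 by (auto simp: card_image card_insert_if)
qed auto

lemma descents_le: "xs \<noteq> [] \<Longrightarrow> descents xs < length xs"
proof (induction xs rule: descents.induct)
  case (1 x y xs)
  then have "descents (y # xs) < length (y # xs)" by simp
  then show ?case by simp
qed simp_all

text \<open>A weight \<open>F\<close> on the number of descents treats all counts at once. It stays
  arbitrary in the induction so that the comparison of the first two letters can be absorbed: the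
  hypothesis is used for \<open>\<lambda>d. F (c + d)\<close>.\<close>

lemma sum_descents_insert:
  fixes F :: "nat \<Rightarrow> real"
  assumes "\<And>x. x \<in> set xs \<Longrightarrow> x < a"
  shows "(\<Sum>q\<le>length xs. F (descents (take q xs @ a # drop q xs))) =
    (1 + real (descents xs)) * F (descents xs)
    + (real (length xs) - real (descents xs)) * F (Suc (descents xs))"
  using assms
proof (induction xs arbitrary: F rule: descents.induct)
  case (1 x y xs)
  define c where "c = (if x > y then 1 else 0 :: nat)"
  let ?ins = "\<lambda>q. take q (y # xs) @ a # drop q (y # xs)"
  have len: "{..length (x # y # xs)} = insert 0 (Suc ` {..length (y # xs)})"
    by (simp add: atMost_Suc_eq_insert_0)
  have len': "{..length (y # xs)} = insert 0 (Suc ` {..length xs})"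
    by (simp add: atMost_Suc_eq_insert_0)
  have "(\<Sum>q\<le>length (x # y # xs). F (descents (take q (x # y # xs) @ a # drop q (x # y # xs))))
    = F (descents (a # x # y # xs)) + (\<Sum>q\<le>length (y # xs). F (descents (x # ?ins q)))"
    unfolding len by (subst sum.insert) (simp_all add: sum.reindex del: descents.simps)
  also have "(\<Sum>q\<le>length (y # xs). F (descents (x # ?ins q))) =
     F (descents (x # a # y # xs)) + (\<Sum>q\<le>length xs. F (c + descents (?ins (Suc q))))"
    unfolding len' by (subst sum.insert) (simp_all add: sum.reindex c_def)
  \<comment> \<open>The hypothesis sums over all insertions into \<open>y # xs\<close>; the one in
    front of \<open>y\<close> does not occur here, so it is added and subtracted again.\<close>
  also have "(\<Sum>q\<le>length xs. F (c + descents (?ins (Suc q)))) =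
     (\<Sum>q\<le>length (y # xs). F (c + descents (?ins q))) - F (c + descents (a # y # xs))"
    unfolding len' by (subst sum.insert) (simp_all add: sum.reindex)
  also have "(\<Sum>q\<le>length (y # xs). F (c + descents (?ins q))) =
    (1 + real (descents (y # xs))) * F (c + descents (y # xs))
    + (real (length (y # xs)) - real (descents (y # xs))) * F (c + Suc (descents (y # xs)))"
    by (rule "1.IH") (use "1.prems" in auto)
  finally have sum: "(\<Sum>q\<le>length (x # y # xs). F (descents (take q (x # y # xs) @ a # drop q (x # y # xs))))
    = F (descents (a # x # y # xs)) + (F (descents (x # a # y # xs))
      + ((1 + real (descents (y # xs))) * F (c + descents (y # xs))
    + (real (length (y # xs)) - real (descents (y # xs))) * F (c + Suc (descents (y # xs)))
    - F (c + descents (a # y # xs))))" .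
  have "x < a" "y < a" using "1.prems" by auto
  then have "descents (x # y # xs) = c + descents (y # xs)"
      "descents (a # x # y # xs) = Suc (c + descents (y # xs))"
      "descents (x # a # y # xs) = Suc (descents (y # xs))"
      "descents (a # y # xs) = Suc (descents (y # xs))"
    by (simp_all add: c_def)
  moreover have "c = 0 \<or> c = 1" by (simp add: c_def)
  ultimately show ?case
    unfolding sum by (elim disjE) (simp_all add: algebra_simps)
qed auto

text \<open>Deleting \<open>a\<close> inverts the insertion: \<open>a\<close> occurs exactly once in
  a word on \<open>insert a A\<close>, so it cuts the word into two determined parts.\<close>

lemma sum_permutations_of_set_insert:
  assumes "finite A" "a \<notin> A"
  shows "(\<Sum>zs\<in>permutations_of_set (insert a A). f zs) =
    (\<Sum>xs\<in>permutations_of_set A. \<Sum>q\<le>length xs. f (take q xs @ a # drop q xs))"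
proof -
  let ?ins = "\<lambda>(xs, q). take q xs @ a # drop q xs"
  let ?S = "SIGMA xs : permutations_of_set A. {..length xs}"
  have "inj_on ?ins ?S"
  proof (rule inj_onI)
    fix u v assume "u \<in> ?S" "v \<in> ?S" and eq: "?ins u = ?ins v"
    then obtain xs q ys k where *: "u = (xs, q)" "v = (ys, k)" "a \<notin> set xs" "a \<notin> set ys"
        "q \<le> length xs" "k \<le> length ys"
      using assms(2) by (auto simp: permutations_of_set_def)
    have "a \<notin> set (take q xs)" "a \<notin> set (take k ys)" "a \<notin> set (drop q xs)" "a \<notin> set (drop k ys)"
      using * by (meson in_set_takeD in_set_dropD)+
    with eq * have "take q xs = take k ys \<and> drop q xs = drop k ys"
      by (simp add: append_Cons_eq_iff)
    with * show "u = v"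
      by (metis append_take_drop_id length_take min.absorb2)
  qed
  moreover have "?ins ` ?S = permutations_of_set (insert a A)"
  proof (intro equalityI subsetI)
    fix zs assume "zs \<in> ?ins ` ?S"
    then obtain xs q where *: "xs \<in> permutations_of_set A" "zs = take q xs @ a # drop q xs"
      by auto
    \<comment> \<open>Moving \<open>a\<close> to the front changes neither the letters nor their
      distinctness, and \<open>a # xs\<close> is easy to judge.\<close>
    have "mset zs = add_mset a (mset (take q xs @ drop q xs))"
      unfolding * by (simp del: append_take_drop_id)
    then have "mset zs = mset (a # xs)" by simp
    then have "set zs = set (a # xs)" "distinct zs = distinct (a # xs)"
      by (metis set_mset_mset) (metis \<open>mset zs = mset (a # xs)\<close> mset_eq_imp_distinct_iff)
    then show "zs \<in> permutations_of_set (insert a A)"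
      using * assms by (auto simp: permutations_of_set_def)
  next
    fix zs assume zs: "zs \<in> permutations_of_set (insert a A)"
    then have "a \<in> set zs" "distinct zs" by (auto simp: permutations_of_set_def)
    then obtain xs ys where *: "zs = xs @ a # ys" by (meson split_list)
    then have "xs @ ys \<in> permutations_of_set A"
      using zs assms by (auto simp: permutations_of_set_def)
    then have "(xs @ ys, length xs) \<in> ?S" by simp
    then show "zs \<in> ?ins ` ?S" by (rule rev_image_eqI) (simp add: *)
  qed
  ultimately have "(\<Sum>zs\<in>permutations_of_set (insert a A). f zs) = (\<Sum>u\<in>?S. f (?ins u))"
    using sum.reindex[of ?ins ?S f] by simp
  also have "\<dots> = (\<Sum>xs\<in>permutations_of_set A. \<Sum>q\<le>length xs. f (take q xs @ a # drop q xs))"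
    by (subst sum.Sigma) (auto simp: case_prod_beta)
  finally show ?thesis .
qed

section \<open>Eulerian numbers: words in one-line notation and the recurrence\<close>

lemma eulerian_conv_list:
  "eulerian r j = card {xs \<in> permutations_of_set {1..r}. int (descents xs) = j}"
proof -
  let ?P = "{\<pi>. \<pi> permutes {1..r}}"
  let ?g = "\<lambda>\<pi>. map \<pi> [1..<Suc r]"
  have inj: "inj_on ?g ?P"
  proof (rule inj_onI)
    fix \<pi> \<sigma> assume *: "\<pi> \<in> ?P" "\<sigma> \<in> ?P" and eq: "?g \<pi> = ?g \<sigma>"
    from eq have "\<forall>i\<in>set [1..<Suc r]. \<pi> i = \<sigma> i" by (simp only: map_eq_conv)
    then have "\<forall>i\<in>{1..r}. \<pi> i = \<sigma> i" by auto
    with * show "\<pi> = \<sigma>" by (auto simp: permutes_def fun_eq_iff)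
  qed
  have sub: "?g ` ?P \<subseteq> permutations_of_set {1..r}"
  proof
    fix xs assume "xs \<in> ?g ` ?P"
    then obtain \<pi> where \<pi>: "\<pi> permutes {1..r}" "xs = ?g \<pi>" by auto
    have "set [1..<Suc r] = {1..r}" by auto
    then have "set xs = {1..r}" "distinct xs"
      using \<pi> permutes_image[OF \<pi>(1)] permutes_inj_on[OF \<pi>(1)]
      by (simp_all only: distinct_map set_map distinct_upt simp_thms)
    then show "xs \<in> permutations_of_set {1..r}" by (rule permutations_of_setI)
  qed
  \<comment> \<open>Surjectivity by counting: \<open>?g\<close> is injective and both sides have
    \<open>fact r\<close> elements.\<close>
  have img: "?g ` ?P = permutations_of_set {1..r}"
  proof (rule card_subset_eq[OF _ sub])
    show "card (?g ` ?P) = card (permutations_of_set {1..r})"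
      using inj by (simp add: card_image card_permutations)
  qed simp
  have des: "descents (?g \<pi>) = card {i \<in> {1..<r}. \<pi> i > \<pi> (Suc i)}" for \<pi> :: "nat \<Rightarrow> nat"
  proof -
    \<comment> \<open>List positions start at 0 and arguments of \<open>\<pi>\<close> at 1, hence
      the \<open>Suc\<close>.\<close>
    have "{i \<in> {1..<r}. \<pi> i > \<pi> (Suc i)} =
      Suc ` {i. Suc i < length (?g \<pi>) \<and> ?g \<pi> ! i > ?g \<pi> ! Suc i}" (is "?L = ?R")
    proof (rule set_eqI)
      show "i \<in> ?L \<longleftrightarrow> i \<in> ?R" for i
        by (cases i) (auto simp: image_iff simp del: upt_Suc)
    qed
    then show ?thesis by (simp add: descents_conv_card card_image)
  qed
  have "{xs \<in> permutations_of_set {1..r}. int (descents xs) = j} =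
    ?g ` {\<pi>. \<pi> permutes {1..r} \<and> int (descents (?g \<pi>)) = j}"
    unfolding img[symmetric] by auto
  moreover have "inj_on ?g {\<pi>. \<pi> permutes {1..r} \<and> int (descents (?g \<pi>)) = j}"
    by (rule inj_on_subset[OF inj]) auto
  ultimately show ?thesis
    unfolding eulerian_def des[symmetric] by (simp add: card_image del: upt_Suc)
qed

lemma eulerian_conv_sum:
  "real (eulerian r j) =
    (\<Sum>xs\<in>permutations_of_set {1..r}. if int (descents xs) = j then 1 else 0)"
proof -
  have "permutations_of_set {1..r} \<inter> {xs. int (descents xs) = j} =
      {xs \<in> permutations_of_set {1..r}. int (descents xs) = j}" by auto
  then show ?thesis by (simp add: eulerian_conv_list sum.If_cases)
qed

lemma eulerian_Suc:
  "real (eulerian (Suc r) j) =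
    of_int (j + 1) * real (eulerian r j) + of_int (int r - j + 1) * real (eulerian r (j - 1))"
proof -
  let ?F = "\<lambda>d. if int d = j then 1 else 0 :: real"
  have ins: "{1..Suc r} = insert (Suc r) {1..r}" by auto
  have "real (eulerian (Suc r) j) =
    (\<Sum>xs\<in>permutations_of_set {1..r}. \<Sum>q\<le>length xs. ?F (descents (take q xs @ Suc r # drop q xs)))"
    unfolding eulerian_conv_sum ins by (rule sum_permutations_of_set_insert) auto
  also have "\<dots> = (\<Sum>xs\<in>permutations_of_set {1..r}.
      of_int (j + 1) * (if int (descents xs) = j then 1 else 0)
    + of_int (int r - j + 1) * (if int (descents xs) = j - 1 then 1 else 0))"
  proof (rule sum.cong[OF refl])
    fix xs assume xs: "xs \<in> permutations_of_set {1..r}"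
    then have len: "length xs = r"
      by (metis card_atLeastAtMost diff_Suc_1 length_finite_permutations_of_set)
    have "(\<Sum>q\<le>length xs. ?F (descents (take q xs @ Suc r # drop q xs))) =
      (1 + real (descents xs)) * ?F (descents xs)
      + (real (length xs) - real (descents xs)) * ?F (Suc (descents xs))"
      by (rule sum_descents_insert) (use xs in \<open>auto simp: permutations_of_set_def\<close>)
    \<comment> \<open>Where an indicator is nonzero, \<open>descents xs\<close> equals
      \<open>j\<close> or \<open>j - 1\<close>, so the weights no longer depend on
      \<open>xs\<close>.\<close>
    also have "\<dots> = of_int (j + 1) * (if int (descents xs) = j then 1 else 0)
      + of_int (int r - j + 1) * (if int (descents xs) = j - 1 then 1 else 0)"
      using len by auto
    finally show "(\<Sum>q\<le>length xs. ?F (descents (take q xs @ Suc r # drop q xs))) = \<dots>" .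
  qed
  also have "\<dots> = of_int (j + 1) * real (eulerian r j)
      + of_int (int r - j + 1) * real (eulerian r (j - 1))"
    by (simp add: eulerian_conv_sum sum.distrib sum_distrib_left)
  finally show ?thesis .
qed

lemma eulerian_0: "eulerian 0 j = (if j = 0 then 1 else 0)"
proof -
  have "{xs \<in> permutations_of_set {1..0::nat}. int (descents xs) = j} = (if j = 0 then {[]} else {})"
    by (auto simp: permutations_of_set_def)
  then show ?thesis by (simp add: eulerian_conv_list)
qed

text \<open>A nonempty word has fewer descents than letters. Degree 0 is excluded because
  \<open>eulerian 0 0 = 1\<close>.\<close>

lemma eulerian_eq_0:
  assumes "j < 0 \<or> j \<ge> int r" "r > 0"
  shows "eulerian r j = 0"
proof -
  have "int (descents xs) \<noteq> j" if "xs \<in> permutations_of_set {1..r}" for xs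
  proof -
    have "length xs = r" using that
      by (metis card_atLeastAtMost diff_Suc_1 length_finite_permutations_of_set)
    then show ?thesis using descents_le[of xs] assms by auto
  qed
  then show ?thesis by (auto simp: eulerian_conv_list)
qed

section \<open>Finite differences and the explicit formula for the Eulerian numbers\<close>

lemma discrete_deriv_Suc:
  "discrete_deriv (Suc k) q i = discrete_deriv k q i - discrete_deriv k q (i - 1)"
proof -
  let ?c = "\<lambda>j. (-1) ^ j * real (k choose j)"
  \<comment> \<open>\<open>?d\<close> is \<open>?c\<close> shifted by one place; by Pascal's rule
    \<open>?c j - ?d j\<close> is the coefficient of order \<open>Suc k\<close>.\<close>
  let ?d = "\<lambda>j. case j of 0 \<Rightarrow> 0 | Suc l \<Rightarrow> ?c l"
  have "discrete_deriv (Suc k) q i = (\<Sum>j=0..Suc k. (?c j - ?d j) *\<^sub>R q (i - int j))"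
    unfolding discrete_deriv_def
    by (rule sum.cong) (auto simp: algebra_simps split: nat.split)
  also have "\<dots> = (\<Sum>j=0..Suc k. ?c j *\<^sub>R q (i - int j)) - (\<Sum>j=0..Suc k. ?d j *\<^sub>R q (i - int j))"
    by (simp only: scaleR_left_diff_distrib sum_subtractf)
  also have "(\<Sum>j=0..Suc k. ?c j *\<^sub>R q (i - int j)) = discrete_deriv k q i"
    by (simp add: discrete_deriv_def)
  also have "(\<Sum>j=0..Suc k. ?d j *\<^sub>R q (i - int j)) = discrete_deriv k q (i - 1)"
    unfolding discrete_deriv_def
    by (subst sum.atLeast0_atMost_Suc_shift) (simp add: algebra_simps)
  finally show ?thesis .
qed

lemma discrete_deriv_0 [simp]: "discrete_deriv 0 q i = q i"
  by (simp add: discrete_deriv_def)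

lemma discrete_deriv_add: "discrete_deriv k (discrete_deriv l q) i = discrete_deriv (k + l) q i"
  by (induction k arbitrary: i) (simp_all add: discrete_deriv_Suc)

lemma discrete_deriv_cdiv:
  fixes q :: "int \<Rightarrow> real"
  shows "discrete_deriv k (\<lambda>j. q j / c) i = discrete_deriv k q i / c"
  by (simp add: discrete_deriv_def sum_divide_distrib)

lemma discrete_deriv_eq_0:
  assumes "\<And>j. j \<notin> {0..b} \<Longrightarrow> q j = 0" "i \<notin> {0..b + int k}"
  shows "discrete_deriv k q i = 0"
  unfolding discrete_deriv_def
proof (rule sum.neutral, rule ballI)
  fix j assume "j \<in> {0..k}"
  with assms(2) have "i - int j \<notin> {0..b}" by auto
  then show "((-1) ^ j * real (k choose j)) *\<^sub>R q (i - int j) = 0" by (simp add: assms(1))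
qed

text \<open>The truncated power on the integers, without the factor \<open>1 / fact r\<close>. For
  \<open>r = 0\<close> it is the unit step with value 1 at 0, in agreement with
  \<open>pos_power 0\<close>.\<close>

definition nonneg_power :: "nat \<Rightarrow> int \<Rightarrow> real" where
  "nonneg_power r j = (if j \<ge> 0 then of_int j ^ r else 0)"

text \<open>This is the Eulerian recurrence \<open>eulerian_Suc\<close> read at
  \<open>j = i - 1\<close>. It holds already for each coefficient of
  \<open>nonneg_power r (i - int j)\<close>.\<close>

lemma discrete_deriv_nonneg_power_Suc:
  "discrete_deriv (Suc (Suc r)) (nonneg_power (Suc r)) i =
    of_int i * discrete_deriv (Suc r) (nonneg_power r) i
    + of_int (int r + 2 - i) * discrete_deriv (Suc r) (nonneg_power r) (i - 1)"
proof -
  let ?c = "\<lambda>j. (-1) ^ j * real (Suc r choose j)"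
  let ?d = "\<lambda>j. case j of 0 \<Rightarrow> 0 | Suc l \<Rightarrow> ?c l"
  \<comment> \<open>Both terms are brought to the range up to \<open>Suc (Suc r)\<close>: here the
    new top binomial vanishes, in \<open>2\<close> the index is shifted.\<close>
  have 1: "of_int i * discrete_deriv (Suc r) (nonneg_power r) i =
      (\<Sum>j=0..Suc (Suc r). of_int i * ?c j * nonneg_power r (i - int j))"
    by (simp add: discrete_deriv_def sum_distrib_left mult.assoc binomial_eq_0 distrib_left
          right_diff_distrib del: binomial_Suc_Suc)
  have 2: "of_int (int r + 2 - i) * discrete_deriv (Suc r) (nonneg_power r) (i - 1) =
      (\<Sum>j=0..Suc (Suc r). of_int (int r + 2 - i) * ?d j * nonneg_power r (i - int j))"
    by (subst sum.atLeast0_atMost_Suc_shift)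
       (simp add: discrete_deriv_def sum_distrib_left mult.assoc diff_diff_eq add.commute
          right_diff_distrib del: binomial_Suc_Suc)
  \<comment> \<open>Pascal's rule splits \<open>Suc (Suc r) choose j\<close>, and absorption turns
    \<open>j\<close> times it into \<open>Suc (Suc r)\<close> times
    \<open>Suc r choose (j - 1)\<close>.\<close>
  have coeff: "of_int i * ?c j + of_int (int r + 2 - i) * ?d j =
      (-1) ^ j * real (Suc (Suc r) choose j) * of_int (i - int j)" for j
  proof (cases j)
    case (Suc l)
    have "real (Suc l) * real (Suc (Suc r) choose Suc l) = real (Suc (Suc r)) * real (Suc r choose l)"
      using Suc_times_binomial_eq[of "Suc r" l]
      by (metis of_nat_mult mult.commute)
    moreover have "real (Suc (Suc r) choose Suc l) = real (Suc r choose l) + real (Suc r choose Suc l)"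
      by (simp only: binomial_Suc_Suc of_nat_add)
    ultimately have "of_int i * real (Suc r choose Suc l) - of_int (int r + 2 - i) * real (Suc r choose l)
      = real (Suc (Suc r) choose Suc l) * of_int (i - int (Suc l))"
      by (simp add: algebra_simps del: binomial_Suc_Suc)
    then have "(-1) ^ Suc l * (of_int i * real (Suc r choose Suc l)
        - of_int (int r + 2 - i) * real (Suc r choose l))
      = (-1) ^ Suc l * (real (Suc (Suc r) choose Suc l) * of_int (i - int (Suc l)))"
      by (simp only:)
    then show ?thesis unfolding Suc by (simp add: algebra_simps del: binomial_Suc_Suc)
  qed simp
  have power: "nonneg_power (Suc r) j = of_int j * nonneg_power r j" for j
    by (simp add: nonneg_power_def)
  show ?thesis
    unfolding 1 2 sum.distrib[symmetric] distrib_right[symmetric] coeff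
    by (simp add: discrete_deriv_def power mult.assoc del: binomial_Suc_Suc)
qed

lemma discrete_deriv_nonneg_power_0:
  "discrete_deriv (Suc 0) (nonneg_power 0) i = (if i = 0 then 1 else 0)"
  by (simp add: discrete_deriv_Suc nonneg_power_def)

lemma eulerian_conv_discrete_deriv:
  "real (eulerian (Suc r) (i - 1)) = discrete_deriv (Suc (Suc r)) (nonneg_power (Suc r)) i"
proof (induction r arbitrary: i)
  \<comment> \<open>In degree 0 the two sequences differ: \<open>eulerian 0 (i - 1)\<close> is the
    impulse at 1, the difference is the impulse at 0. One step of the two recurrences takes both to
    the impulse at 1.\<close>
  case 0
  show ?case
    unfolding discrete_deriv_nonneg_power_Suc discrete_deriv_nonneg_power_0 eulerian_Suc eulerian_0
    by auto
next
  case (Suc r)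
  show ?case
    unfolding discrete_deriv_nonneg_power_Suc[of "Suc r"] eulerian_Suc[of "Suc r"] Suc
    by (simp add: algebra_simps)
qed

text \<open>The separate value of \<open>eulerian_coeff 0\<close> is the impulse at 0, which the
  difference of the unit step gives as well, so the formula covers all degrees.\<close>

lemma eulerian_coeff_conv_discrete_deriv:
  "eulerian_coeff r = discrete_deriv (Suc r) (\<lambda>j. nonneg_power r j / fact r)"
proof
  show "eulerian_coeff r i = discrete_deriv (Suc r) (\<lambda>j. nonneg_power r j / fact r) i" for i
    unfolding discrete_deriv_cdiv
    by (cases r) (simp_all add: eulerian_coeff_def discrete_deriv_nonneg_power_0
        eulerian_conv_discrete_deriv)
qed

text \<open>The support lies in \<open>{1..r}\<close> for positive \<open>r\<close> and is
  \<open>{0}\<close> for \<open>r = 0\<close>; the interval covers both cases.\<close>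

lemma eulerian_coeff_eq_0: "i \<notin> {0..int r} \<Longrightarrow> eulerian_coeff r i = 0"
  by (auto simp: eulerian_coeff_def intro: eulerian_eq_0)

section \<open>Convolution and differences\<close>

lemma conv_eq_sum:
  assumes "finite S" "\<And>j. j \<notin> S \<Longrightarrow> K j = 0"
  shows "conv K q i = (\<Sum>j\<in>S. K j *\<^sub>R q (i - j))"
  unfolding conv_def by (rule sum.mono_neutral_left) (use assms in auto)

text \<open>Summation by parts: the differences move from \<open>q\<close> to the kernel, with no
  boundary terms because \<open>K\<close> vanishes outside \<open>{0..b}\<close>.\<close>

lemma conv_discrete_deriv:
  assumes "\<And>j. j \<notin> {0..b} \<Longrightarrow> K j = 0"
  shows "conv K (discrete_deriv k q) i =
    (\<Sum>s\<in>{0..b + int k}. discrete_deriv k K s *\<^sub>R q (i - s))"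
proof (induction k arbitrary: i)
  case 0
  show ?case using conv_eq_sum[of "{0..b}" K] assms by simp
next
  case (Suc k)
  let ?D = "discrete_deriv k K"
  have D: "?D s = 0" if "s \<notin> {0..b + int k}" for s
    using assms that by (rule discrete_deriv_eq_0)
  have "conv K (discrete_deriv (Suc k) q) i =
      conv K (discrete_deriv k q) i - conv K (discrete_deriv k q) (i - 1)"
    unfolding conv_def
    by (simp add: discrete_deriv_Suc scaleR_right_diff_distrib sum_subtractf algebra_simps)
  also have "\<dots> = (\<Sum>s\<in>{0..b + int k}. ?D s *\<^sub>R q (i - s))
      - (\<Sum>s\<in>{0..b + int k}. ?D s *\<^sub>R q (i - 1 - s))"
    unfolding Suc ..
  \<comment> \<open>Both sums are extended by zero terms to the range of order \<open>Suc k\<close>,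
    where they can be subtracted termwise.\<close>
  also have "(\<Sum>s\<in>{0..b + int k}. ?D s *\<^sub>R q (i - s)) =
      (\<Sum>s\<in>{0..b + int (Suc k)}. ?D s *\<^sub>R q (i - s))"
    by (rule sum.mono_neutral_left) (use D in auto)
  also have "(\<Sum>s\<in>{0..b + int k}. ?D s *\<^sub>R q (i - 1 - s)) =
      (\<Sum>s\<in>{1..b + int (Suc k)}. ?D (s - 1) *\<^sub>R q (i - s))"
    by (rule sum.reindex_bij_witness[of _ "\<lambda>s. s - 1" "\<lambda>s. s + 1"]) (auto simp: algebra_simps)
  also have "\<dots> = (\<Sum>s\<in>{0..b + int (Suc k)}. ?D (s - 1) *\<^sub>R q (i - s))"
    by (rule sum.mono_neutral_left) (use D in auto)
  finally show ?case
    by (simp add: discrete_deriv_Suc scaleR_left_diff_distrib sum_subtractf)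
qed

section \<open>Polynomial pieces and support of the B-spline\<close>

lemma pos_power_add_of_int:
  assumes "0 \<le> u" "u < 1"
  shows "pos_power m (u + of_int j) / fact m =
    (\<Sum>k=0..m. u ^ k / fact k * (nonneg_power (m - k) j / fact (m - k)))"
\<comment> \<open>As \<open>u\<close> lies in \<open>[0, 1)\<close>, the sign of
  \<open>u + j\<close> is decided by \<open>j\<close>: either no truncation occurs and the binomial
  theorem applies, or both sides vanish.\<close>
proof (cases "j \<ge> 0")
  case True
  with assms have "u + of_int j \<ge> 0" by simp
  then have "pos_power m (u + of_int j) / fact m = (u + of_int j) ^ m / fact m"
    by (simp add: pos_power_def)
  also have "\<dots> = (\<Sum>k=0..m. u ^ k / fact k * (of_int j ^ (m - k) / fact (m - k)))"
    unfolding binomial_ring sum_divide_distrib atMost_atLeast0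
    by (rule sum.cong) (simp_all add: binomial_fact)
  finally show ?thesis using True by (simp add: nonneg_power_def)
next
  case False
  then have "of_int j \<le> (-1 :: real)" by linarith
  with assms have "u + of_int j < 0" by linarith
  then show ?thesis using False by (simp add: nonneg_power_def pos_power_def)
qed

lemma bspline_add_of_int:
  assumes "0 \<le> u" "u < 1"
  shows "bspline m (u + of_int s) =
    (\<Sum>k=0..m. u ^ k / fact k * discrete_deriv k (eulerian_coeff (m - k)) s)"
proof -
  let ?c = "\<lambda>l. (-1) ^ l * real (Suc m choose l)"
  let ?T = "\<lambda>k j. nonneg_power (m - k) j / fact (m - k)"
  have "bspline m (u + of_int s) =
      (\<Sum>l=0..Suc m. ?c l * (pos_power m (u + of_int (s - int l)) / fact m))"
    by (simp add: bspline_def sum_distrib_left algebra_simps del: binomial_Suc_Suc)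
  also have "\<dots> = (\<Sum>l=0..Suc m. \<Sum>k=0..m. ?c l * (u ^ k / fact k * ?T k (s - int l)))"
    unfolding pos_power_add_of_int[OF assms] sum_distrib_left ..
  also have "\<dots> = (\<Sum>k=0..m. \<Sum>l=0..Suc m. ?c l * (u ^ k / fact k * ?T k (s - int l)))"
    by (rule sum.swap)
  also have "\<dots> = (\<Sum>k=0..m. u ^ k / fact k * discrete_deriv (Suc m) (?T k) s)"
    unfolding discrete_deriv_def sum_distrib_left
    by (intro sum.cong refl) (simp only: real_scaleR_def mult_ac)
  \<comment> \<open>Split \<open>Suc m\<close> as \<open>k + Suc (m - k)\<close>: the inner
    difference of order \<open>Suc (m - k)\<close> produces
    \<open>eulerian_coeff (m - k)\<close>.\<close>
  also have "\<dots> = (\<Sum>k=0..m. u ^ k / fact k * discrete_deriv k (eulerian_coeff (m - k)) s)"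
    by (intro sum.cong refl) (simp add: eulerian_coeff_conv_discrete_deriv discrete_deriv_add)
  finally show ?thesis .
qed

text \<open>Seen on the pieces: \<open>eulerian_coeff (m - k)\<close> lives on
  \<open>{0..m - k}\<close> and \<open>k\<close> differences widen this to \<open>{0..m}\<close>, so
  all coefficients vanish when the integer part of \<open>x\<close> is outside.\<close>

lemma bspline_eq_0:
  assumes "x \<notin> {0..<real m + 1}"
  shows "bspline m x = 0"
proof -
  have "\<lfloor>x\<rfloor> \<notin> {0..int m}" using assms by (auto simp: le_floor_iff floor_le_iff)
  then have "discrete_deriv k (eulerian_coeff (m - k)) \<lfloor>x\<rfloor> = 0" if "k \<le> m" for k
    using that by (intro discrete_deriv_eq_0[of "int (m - k)"] eulerian_coeff_eq_0) auto
  moreover have "x = frac x + of_int \<lfloor>x\<rfloor>" by (simp add: frac_def)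
  ultimately show ?thesis
    using bspline_add_of_int[of "frac x" m "\<lfloor>x\<rfloor>"] frac_lt_1[of x] by simp
qed

section \<open>The B-spline series and the periodic spline\<close>

lemma bspline_support: "bspline m (x - of_int i) \<noteq> 0 \<Longrightarrow> i \<in> {\<lfloor>x\<rfloor> - int m..\<lfloor>x\<rfloor>}"
proof -
  assume "bspline m (x - of_int i) \<noteq> 0"
  then have "x - of_int i \<in> {0..<real m + 1}" using bspline_eq_0 by blast
  then show ?thesis by (auto simp: le_floor_iff) linarith
qed

text \<open>Substituting \<open>s = \<lfloor>x\<rfloor> - i\<close> separates the fractional part,
  which enters the weights, from the integer part, which enters the index. This gives both the
  comparison with a spline piece and the periodicity.\<close>

lemma infsum_bspline:
  fixes q :: "int \<Rightarrow> 'a::real_normed_vector"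
  shows "(\<Sum>\<^sub>\<infinity>i::int. bspline m (x - of_int i) *\<^sub>R q i) =
    (\<Sum>s\<in>{0..int m}. bspline m (frac x + of_int s) *\<^sub>R q (\<lfloor>x\<rfloor> - s))"
proof -
  have "(\<Sum>\<^sub>\<infinity>i::int. bspline m (x - of_int i) *\<^sub>R q i) =
      (\<Sum>\<^sub>\<infinity>i\<in>{\<lfloor>x\<rfloor> - int m..\<lfloor>x\<rfloor>}. bspline m (x - of_int i) *\<^sub>R q i)"
    by (rule infsum_cong_neutral) (use bspline_support[of m x] in auto)
  also have "\<dots> = (\<Sum>i\<in>{\<lfloor>x\<rfloor> - int m..\<lfloor>x\<rfloor>}. bspline m (x - of_int i) *\<^sub>R q i)"
    by simp
  also have "\<dots> = (\<Sum>s\<in>{0..int m}. bspline m (frac x + of_int s) *\<^sub>R q (\<lfloor>x\<rfloor> - s))"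
    by (rule sum.reindex_bij_witness[of _ "\<lambda>s. \<lfloor>x\<rfloor> - s" "\<lambda>i. \<lfloor>x\<rfloor> - i"]) (auto simp: frac_def)
  finally show ?thesis .
qed

lemma spline_piece_conv_bspline:
  assumes "0 \<le> u" "u < 1"
  shows "spline_piece m n p i u =
    (\<Sum>s\<in>{0..int m}. bspline m (u + of_int s) *\<^sub>R cyc n p (i - s))"
proof -
  let ?D = "\<lambda>k. discrete_deriv k (eulerian_coeff (m - k))"
  have "spline_piece m n p i u = (\<Sum>k=0..m. (u ^ k / fact k) *\<^sub>R
      (\<Sum>s\<in>{0..int m}. ?D k s *\<^sub>R cyc n p (i - s)))"
    unfolding spline_piece_def
  proof (intro sum.cong refl)
    fix k assume "k \<in> {0..m}"
    \<comment> \<open>The range of \<open>s\<close> thus does not depend on \<open>k\<close>, which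
      allows the sums to be swapped below.\<close>
    then have deg: "int (m - k) + int k = int m" by simp
    have "conv (eulerian_coeff (m - k)) (discrete_deriv k (cyc n p)) i =
        (\<Sum>s\<in>{0..int m}. ?D k s *\<^sub>R cyc n p (i - s))"
      by (simp only: conv_discrete_deriv[OF eulerian_coeff_eq_0] deg)
    then show "(u ^ k / fact k * indicator {0..<1} u) *\<^sub>R
        conv (eulerian_coeff (m - k)) (discrete_deriv k (cyc n p)) i =
      (u ^ k / fact k) *\<^sub>R (\<Sum>s\<in>{0..int m}. ?D k s *\<^sub>R cyc n p (i - s))"
      using assms by simp
  qed
  also have "\<dots> = (\<Sum>s\<in>{0..int m}. bspline m (u + of_int s) *\<^sub>R cyc n p (i - s))"
    unfolding bspline_add_of_int[OF assms] scaleR_sum_right scaleR_sum_left scaleR_scaleR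
    by (rule sum.swap)
  finally show ?thesis .
qed

lemma spline_piece_eq_0: "x \<notin> {0..<1} \<Longrightarrow> spline_piece m n p i x = 0"
  by (simp add: spline_piece_def)

theorem proposition2p7:
  fixes m n :: nat and p :: "nat \<Rightarrow> real ^ 'd"
  assumes "n \<ge> 1"
  shows "(\<forall>t\<in>{0..<1}. periodic_spline m n p t =
            (\<Sum>\<^sub>\<infinity>i::int. bspline m (real n * t - of_int i) *\<^sub>R cyc n p i))
       \<and> (\<forall>x. x \<notin> {0..<real m + 1} \<longrightarrow> bspline m x = 0)
       \<and> (\<forall>t::real. finite {i::int. bspline m (real n * t - of_int i) *\<^sub>R cyc n p i \<noteq> 0})
       \<and> (\<forall>t::real. (\<Sum>\<^sub>\<infinity>i::int. bspline m (real n * (t + 1) - of_int i) *\<^sub>R cyc n p i) =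
            (\<Sum>\<^sub>\<infinity>i::int. bspline m (real n * t - of_int i) *\<^sub>R cyc n p i))"
proof (intro conjI ballI allI impI)
  fix t :: real assume "t \<in> {0..<1}"
  then have t: "0 \<le> real n * t" "real n * t < real n" using assms by auto
  \<comment> \<open>The only piece whose argument falls into \<open>[0, 1)\<close>; that argument is
    the fractional part of \<open>real n * t\<close>.\<close>
  define i where "i = nat \<lfloor>real n * t\<rfloor>"
  have i: "int i = \<lfloor>real n * t\<rfloor>" "i < n"
    using t by (auto simp: i_def nat_less_iff floor_less_iff)
  then have frac: "real n * t - real i = frac (real n * t)"
    by (metis frac_def of_int_of_nat_eq)
  have "periodic_spline m n p t = (\<Sum>j\<in>{i}. spline_piece m n p (int j) (real n * t - real j))"
    unfolding periodic_spline_def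
  proof (rule sum.mono_neutral_right)
    show "\<forall>j\<in>{0..<n} - {i}. spline_piece m n p (int j) (real n * t - real j) = 0"
    proof
      fix j assume "j \<in> {0..<n} - {i}"
      then have "int j \<noteq> \<lfloor>real n * t\<rfloor>" using i by auto
      then have "real n * t - real j \<notin> {0..<1}" using floor_unique[of "int j"] by fastforce
      then show "spline_piece m n p (int j) (real n * t - real j) = 0" by (rule spline_piece_eq_0)
    qed
  qed (use i in auto)
  also have "\<dots> = (\<Sum>\<^sub>\<infinity>i::int. bspline m (real n * t - of_int i) *\<^sub>R cyc n p i)"
    by (simp add: frac infsum_bspline i spline_piece_conv_bspline frac_lt_1)
  finally show "periodic_spline m n p t = \<dots>" .
next
  fix x assume "x \<notin> {0..<real m + 1}"
  then show "bspline m x = 0" by (rule bspline_eq_0)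
next
  fix t :: real
  show "finite {i::int. bspline m (real n * t - of_int i) *\<^sub>R cyc n p i \<noteq> 0}"
    by (rule finite_subset[of _ "{\<lfloor>real n * t\<rfloor> - int m..\<lfloor>real n * t\<rfloor>}"])
       (use bspline_support in auto)
next
  fix t :: real
  \<comment> \<open>Raising \<open>t\<close> by 1 keeps the fractional part and shifts the integer
    part by \<open>n\<close>, which \<open>cyc n p\<close> does not notice.\<close>
  have "real n * (t + 1) = real n * t + of_int (int n)" by (simp add: algebra_simps)
  then have "\<lfloor>real n * (t + 1)\<rfloor> = \<lfloor>real n * t\<rfloor> + int n" "frac (real n * (t + 1)) = frac (real n * t)"
    by (simp_all only: floor_add_int[symmetric] frac_def of_int_add)
  then show "(\<Sum>\<^sub>\<infinity>i::int. bspline m (real n * (t + 1) - of_int i) *\<^sub>R cyc n p i) =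
      (\<Sum>\<^sub>\<infinity>i::int. bspline m (real n * t - of_int i) *\<^sub>R cyc n p i)"
    by (simp add: infsum_bspline cyc_def add_diff_eq[symmetric] add.commute)
qed

end
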